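(* Let $n$ be an odd composite number with prime factorization $n=p_1^{l_1}\cdots p_k^{l_k}$ (distinct primes $p_j$, exponents $l_j\ge 1$). Then $n$ is an overpseudoprime to base 2 if and only if for every vector of integers $(i_1,\ldots,i_k)$ with $0\le i_j\le l_j$ for all $j$ and not all $i_j=0$, we have $h(n)=h(p_1^{i_1}\cdots p_k^{i_k})$.
   Context: For an odd integer $m>1$, $h(m)$ denotes the multiplicative order of 2 modulo $m$. The cyclotomic cosets of 2 modulo $m$ are the orbits of the set $\{1,2,\ldots,m-1\}$ under the map $x\mapsto 2x \bmod m$; $r(m)$ denotes the number of distinct cyclotomic cosets of 2 modulo $m$. An odd composite number $n$ is called an overpseudoprime to base 2 if $n=r(n)h(n)+1$. *)

theory Defs
  imports "HOL-Number_Theory.Number_Theory" "HOL-Combinatorics.Orbits"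
begin

definition h :: "nat \<Rightarrow> nat" where
  "h m = ord m 2"

(* The library orbit of f at x consists of the iterates f^d x with d > 0. It contains x itself
   here because m is odd, so that doubling modulo m permutes {1..<m}. *)
definition cyclotomic_cosets :: "nat \<Rightarrow> nat set set" where
  "cyclotomic_cosets m = orbit (\<lambda>x. 2 * x mod m) ` {1..<m}"

definition r :: "nat \<Rightarrow> nat" where
  "r m = card (cyclotomic_cosets m)"

definition overpseudoprime :: "nat \<Rightarrow> bool" where
  "overpseudoprime n \<longleftrightarrow> odd n \<and> n > 1 \<and> \<not> prime n \<and> n = r n * h n + 1"

end

theory Submission
  imports Defs
begin

text \<open>The orbit of \<open>x\<close> under doubling modulo \<open>n\<close> has exactly \<open>h (n / gcd x n)\<close> elements, and
  \<open>h d\<close> divides \<open>h n\<close> whenever \<open>d\<close> divides \<open>n\<close>. Hence \<open>n - 1\<close> is a sum of \<open>r n\<close> orbit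
  sizes, each at most \<open>h n\<close>, and it equals \<open>r n * h n\<close> iff all of them are equal to \<open>h n\<close>.
  As \<open>n / gcd x n\<close> runs through all divisors \<open>d > 1\<close> of \<open>n\<close>, this says that \<open>h d = h n\<close> for
  all these \<open>d\<close>.\<close>

lemma funpow_mult_mod:
  fixes c n x :: nat
  assumes "x < n"
  shows "((\<lambda>x. c * x mod n) ^^ m) x = c ^ m * x mod n"
proof (induction m)
  case (Suc m)
  then show ?case
    by (simp add: mod_mult_right_eq mult.assoc)
qed (use assms in simp)

text \<open>With \<open>g = gcd x n\<close>, \<open>x = y * g\<close> and \<open>n = d * g\<close>,
  the factor \<open>g\<close> cancels from both sides and from the modulus; then \<open>y\<close>,
  coprime to \<open>d\<close>, cancels modulo \<open>d\<close>.\<close>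

lemma cong_mult_right_iff_gcd:
  fixes a b n x :: nat
  assumes "n > 0"
  shows "[a * x = b * x] (mod n) \<longleftrightarrow> [a = b] (mod (n div gcd x n))"
proof -
  define g where "g = gcd x n"
  obtain y d where xy: "x = y * g" "n = d * g" "coprime y d"
    unfolding g_def using gcd_coprime_exists[of x n] assms by (metis gcd_eq_0_iff less_not_refl)
  have g: "g > 0"
    using assms by (simp add: g_def)
  have "[a * x = b * x] (mod n) \<longleftrightarrow> g * (a * y) mod (g * d) = g * (b * y) mod (g * d)"
    by (simp add: cong_def xy ac_simps)
  also have "\<dots> \<longleftrightarrow> [a * y = b * y] (mod d)"
    using g by (simp add: cong_def flip: mult_mod_right)
  also have "\<dots> \<longleftrightarrow> [a = b] (mod d)"
    using xy by (intro cong_mult_rcancel_nat)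
  also have "d = n div gcd x n"
    using g xy(2) by (metis g_def nonzero_mult_div_cancel_right less_not_refl)
  finally show ?thesis .
qed

lemma h_pos: "odd n \<Longrightarrow> h n > 0"
  by (simp add: h_def)

text \<open>The congruence of \<open>2 ^ h n\<close> and 1 modulo \<open>n\<close> descends to the
  divisor \<open>d\<close>, so the order modulo \<open>d\<close> divides the exponent
  \<open>h n\<close>.\<close>

lemma h_dvd_h:
  assumes "d dvd n"
  shows "h d dvd h n"
  unfolding h_def using cong_dvd_modulus_nat[OF ord assms] by (simp add: ord_divides')

text \<open>Two iterates of doubling at \<open>x\<close> coincide iff the powers of 2 agree modulo
  \<open>n div gcd x n\<close>, that is, iff the exponents agree modulo the order of 2 there. The
  exponents below this order thus list the orbit without repetition.\<close>

lemma
  fixes n x :: nat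
  assumes "odd n" and "x < n"
  shows card_orbit_double: "card (orbit (\<lambda>x. 2 * x mod n) x) = h (n div gcd x n)"
    and self_in_orbit_double: "x \<in> orbit (\<lambda>x. 2 * x mod n) x"
proof -
  define f where "f = (\<lambda>x. 2 * x mod n)"
  define d where "d = n div gcd x n"
  have "d dvd n"
    unfolding d_def by (metis dvd_div_mult_self dvd_triv_left gcd_dvd2)
  then have "odd d"
    using assms by (meson dvd_trans)
  have eq_iff: "(f ^^ a) x = (f ^^ b) x \<longleftrightarrow> [a = b] (mod h d)" for a b
  proof -
    have "(f ^^ a) x = (f ^^ b) x \<longleftrightarrow> [2 ^ a * x = 2 ^ b * x] (mod n)"
      by (simp add: f_def funpow_mult_mod assms cong_def)
    also have "\<dots> \<longleftrightarrow> [2 ^ a = (2 :: nat) ^ b] (mod d)"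
      unfolding d_def using assms by (intro cong_mult_right_iff_gcd) simp
    also have "\<dots> \<longleftrightarrow> [a = b] (mod h d)"
      unfolding h_def using \<open>odd d\<close> by (intro order_divides_expdiff) simp
    finally show ?thesis .
  qed
  \<comment> \<open>The orbit closes after \<open>h d\<close> steps. As \<open>h d > 0\<close>, this
    also puts \<open>x\<close> into its own orbit, which consists of positive iterates only.\<close>
  have per: "(f ^^ h d) x = x"
    using eq_iff[of "h d" 0] by (simp add: cong_def)
  have "orbit f x = (\<lambda>m. (f ^^ m) x) ` {..<h d}"
    using orbit_altdef_bounded[OF per] h_pos[OF \<open>odd d\<close>] by auto
  moreover have "inj_on (\<lambda>m. (f ^^ m) x) {..<h d}"
    by (auto simp: inj_on_def eq_iff cong_def)
  ultimately show "card (orbit (\<lambda>x. 2 * x mod n) x) = h (n div gcd x n)"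
    by (simp add: card_image f_def d_def)
  show "x \<in> orbit (\<lambda>x. 2 * x mod n) x"
    using per h_pos[OF \<open>odd d\<close>] unfolding orbit_altdef f_def
    by (metis (mono_tags, lifting) mem_Collect_eq)
qed

lemma orbit_double_subset:
  fixes n x :: nat
  assumes "odd n" and "x \<in> {1..<n}"
  shows "orbit (\<lambda>x. 2 * x mod n) x \<subseteq> {1..<n}"
proof
  have step: "2 * y mod n \<in> {1..<n}" if "y \<in> {1..<n}" for y
  proof -
    \<comment> \<open>The odd \<open>n\<close> is coprime to 2, so it would have to divide
      \<open>y\<close>, where \<open>0 < y < n\<close>.\<close>
    have "\<not> n dvd 2 * y"
      using that assms(1) by (auto simp: coprime_dvd_mult_right_iff dest: dvd_imp_le)
    then show ?thesis
      using that by (simp add: dvd_eq_mod_eq_0 Suc_le_eq)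
  qed
  fix z assume "z \<in> orbit (\<lambda>x. 2 * x mod n) x"
  then show "z \<in> {1..<n}"
    by induction (use assms(2) step in blast)+
qed

lemma Union_cyclotomic_cosets:
  assumes "odd n"
  shows "\<Union> (cyclotomic_cosets n) = {1..<n}"
  using orbit_double_subset[OF assms] self_in_orbit_double[OF assms]
  unfolding cyclotomic_cosets_def by fastforce

text \<open>Each coset is cyclic under doubling, hence the orbit of any of its elements; a common
  element would make two cosets equal.\<close>

lemma disjoint_cyclotomic_cosets:
  assumes "odd n"
  shows "pairwise disjnt (cyclotomic_cosets n)"
proof (rule pairwiseI)
  fix A B
  assume A: "A \<in> cyclotomic_cosets n" and B: "B \<in> cyclotomic_cosets n" and "A \<noteq> B"
  have cyc: "cyclic_on (\<lambda>x. 2 * x mod n) C" if "C \<in> cyclotomic_cosets n" for C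
    using that self_in_orbit_double[OF assms] unfolding cyclotomic_cosets_def
    by (fastforce intro: cyclic_on_singleI)
  show "disjnt A B"
    using orbit_cyclic_eq3[OF cyc[OF A]] orbit_cyclic_eq3[OF cyc[OF B]] \<open>A \<noteq> B\<close>
    unfolding disjnt_def by blast
qed

lemma sum_card_cyclotomic_cosets:
  assumes "odd n"
  shows "(\<Sum>A\<in>cyclotomic_cosets n. card A) = n - 1"
proof -
  have "finite A" if "A \<in> cyclotomic_cosets n" for A
    using that Union_cyclotomic_cosets[OF assms]
    by (metis Union_upper finite_atLeastLessThan finite_subset)
  then show ?thesis
    using card_Union_disjoint[OF disjoint_cyclotomic_cosets[OF assms]]
    by (simp add: Union_cyclotomic_cosets[OF assms])
qed

text \<open>A single term below the bound \<open>c\<close> would make the whole sum strictly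
  smaller.\<close>

lemma sum_eq_card_mult_iff:
  fixes g :: "'a \<Rightarrow> nat"
  assumes "finite A" and "\<And>x. x \<in> A \<Longrightarrow> g x \<le> c"
  shows "sum g A = card A * c \<longleftrightarrow> (\<forall>x\<in>A. g x = c)"
  using sum_mono_inv[of g A "\<lambda>_. c"] assms by auto

text \<open>The quotient 1 is excluded by \<open>gcd x n \<le> x < n\<close>; conversely,
  \<open>d\<close> arises from its cofactor \<open>x = n div d\<close>. The conjunct
  \<open>n > 0\<close> covers \<open>n = 0\<close>, where every \<open>d\<close> is a divisor but
  \<open>{1..<n}\<close> is empty.\<close>

lemma div_gcd_image:
  fixes n :: nat
  shows "(\<lambda>x. n div gcd x n) ` {1..<n} = {d. d dvd n \<and> d > 1 \<and> n > 0}"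
proof (intro equalityI subsetI)
  fix d assume "d \<in> (\<lambda>x. n div gcd x n) ` {1..<n}"
  then obtain x where x: "x \<ge> 1" "x < n" "d = n div gcd x n"
    by auto
  have "n = d * gcd x n"
    using x by simp
  moreover have "gcd x n \<le> x"
    using x by (intro dvd_imp_le) auto
  ultimately have "d \<noteq> 0" "d \<noteq> 1"
    using x(1,2) by (metis mult_zero_left not_less_zero, metis mult_1 not_less)
  with x \<open>n = d * gcd x n\<close> show "d \<in> {d. d dvd n \<and> d > 1 \<and> n > 0}"
    by (metis (mono_tags, lifting) dvd_triv_left less_one linorder_neqE_nat mem_Collect_eq
        not_less_zero neq0_conv)
next
  fix d assume "d \<in> {d. d dvd n \<and> d > 1 \<and> n > 0}"
  then obtain g where "n = d * g" "d > 1" "g > 0"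
    by (metis (mono_tags, lifting) dvdE mem_Collect_eq mult_0_right neq0_conv)
  then have "n div gcd g n = d" "g \<in> {1..<n}"
    by auto
  then show "d \<in> (\<lambda>x. n div gcd x n) ` {1..<n}"
    by blast
qed

lemma overpseudoprime_iff_divisors:
  assumes "odd n" and "n > 1" and "\<not> prime n"
  shows "overpseudoprime n \<longleftrightarrow> (\<forall>d. d dvd n \<and> d > 1 \<longrightarrow> h d = h n)"
proof -
  have le: "h (n div gcd x n) \<le> h n" for x
    using h_pos[OF assms(1)] by (metis dvd_div_mult_self dvd_imp_le dvd_triv_left gcd_dvd2 h_dvd_h)
  \<comment> \<open>The coset sizes add up to \<open>n - 1\<close>, and \<open>n > 1\<close> keeps
    this subtraction from truncating.\<close>
  have "overpseudoprime n \<longleftrightarrow> (\<Sum>A\<in>cyclotomic_cosets n. card A) = r n * h n"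
    using assms sum_card_cyclotomic_cosets[OF assms(1)] by (auto simp: overpseudoprime_def)
  also have "\<dots> \<longleftrightarrow> (\<forall>A\<in>cyclotomic_cosets n. card A = h n)"
    unfolding r_def
    by (rule sum_eq_card_mult_iff)
      (auto simp: cyclotomic_cosets_def card_orbit_double[OF assms(1)] le)
  also have "\<dots> \<longleftrightarrow> (\<forall>d\<in>(\<lambda>x. n div gcd x n) ` {1..<n}. h d = h n)"
    by (auto simp: cyclotomic_cosets_def card_orbit_double[OF assms(1)])
  also have "\<dots> \<longleftrightarrow> (\<forall>d. d dvd n \<and> d > 1 \<longrightarrow> h d = h n)"
    unfolding div_gcd_image using assms by auto
  finally show ?thesis .
qed

text \<open>By induction, a divisor of a product splits into divisors of the factors. This serves to
  split a divisor of \<open>n\<close> along its prime powers.\<close>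

lemma dvd_prodE:
  fixes d :: nat
  assumes "finite A" and "d dvd prod f A"
  obtains g where "\<forall>j\<in>A. g j dvd f j" and "d = prod g A"
  using assms
proof (induction A arbitrary: d thesis rule: finite_induct)
  case empty
  then show ?case
    by simp
next
  case (insert a A)
  then obtain x y where xy: "d = x * y" "x dvd f a" "y dvd prod f A"
    by (metis dvd_productE prod.insert)
  then obtain g where g: "\<forall>j\<in>A. g j dvd f j" "y = prod g A"
    using insert.IH by blast
  have "prod (g(a := x)) A = prod g A"
    using insert.hyps by (intro prod.cong) auto
  then show ?case
    using insert.hyps xy g by (intro insert.prems(1)[of "g(a := x)"]) auto
qed

theorem theorem2:
  fixes n k :: nat and p l :: "nat \<Rightarrow> nat"
  assumes "odd n" and "n > 1" and "\<not> prime n"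
    and "\<forall>j\<in>{1..k}. prime (p j)"
    and "inj_on p {1..k}"
    and "\<forall>j\<in>{1..k}. l j \<ge> 1"
    and "n = (\<Prod>j=1..k. p j ^ l j)"
  shows "overpseudoprime n \<longleftrightarrow>
    (\<forall>i :: nat \<Rightarrow> nat.
      (\<forall>j\<in>{1..k}. i j \<le> l j) \<and> (\<exists>j\<in>{1..k}. i j \<noteq> 0)
        \<longrightarrow> h n = h (\<Prod>j=1..k. p j ^ i j))"
proof -
  have "overpseudoprime n \<longleftrightarrow> (\<forall>d. d dvd n \<and> d > 1 \<longrightarrow> h d = h n)"
    using assms(1-3) by (rule overpseudoprime_iff_divisors)
  also have "\<dots> \<longleftrightarrow> (\<forall>i :: nat \<Rightarrow> nat.
      (\<forall>j\<in>{1..k}. i j \<le> l j) \<and> (\<exists>j\<in>{1..k}. i j \<noteq> 0)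
        \<longrightarrow> h n = h (\<Prod>j=1..k. p j ^ i j))"
  proof (intro iffI allI impI)
    fix i :: "nat \<Rightarrow> nat"
    assume h_eq: "\<forall>d. d dvd n \<and> d > 1 \<longrightarrow> h d = h n"
      and i: "(\<forall>j\<in>{1..k}. i j \<le> l j) \<and> (\<exists>j\<in>{1..k}. i j \<noteq> 0)"
    define d where "d = (\<Prod>j=1..k. p j ^ i j)"
    have "d dvd n"
      unfolding d_def assms(7) using i by (intro prod_dvd_prod le_imp_power_dvd) auto
    obtain j where j: "j \<in> {1..k}" "i j \<noteq> 0"
      using i by blast
    \<comment> \<open>A nonzero exponent leaves a prime factor in \<open>d\<close>, which rules out
      \<open>d = 1\<close>.\<close>
    then have "p j dvd d"
      unfolding d_def by (meson dvd_power dvd_prodI dvd_trans finite_atLeastAtMost gr0I)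
    then have "d \<noteq> 1"
      using assms(4) j(1) by (metis not_prime_unit)
    moreover have "d \<noteq> 0"
      using \<open>d dvd n\<close> assms(2) by (metis dvd_0_left_iff not_less_zero)
    ultimately show "h n = h (\<Prod>j=1..k. p j ^ i j)"
      using h_eq \<open>d dvd n\<close> unfolding d_def by (metis less_one nat_neq_iff)
  next
    fix d
    assume h_eq: "\<forall>i :: nat \<Rightarrow> nat.
        (\<forall>j\<in>{1..k}. i j \<le> l j) \<and> (\<exists>j\<in>{1..k}. i j \<noteq> 0)
          \<longrightarrow> h n = h (\<Prod>j=1..k. p j ^ i j)"
      and d: "d dvd n \<and> d > 1"
    obtain g where g: "\<forall>j\<in>{1..k}. g j dvd p j ^ l j" "d = prod g {1..k}"
      using d assms(7) dvd_prodE[of "{1..k}"] by blast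
    \<comment> \<open>Divisors of a prime power are powers of the same prime; their exponents form
      the vector \<open>i\<close>.\<close>
    have "\<forall>j\<in>{1..k}. \<exists>e\<le>l j. g j = p j ^ e"
      using g(1) assms(4) by (simp add: divides_primepow_nat)
    then obtain i where i: "\<forall>j\<in>{1..k}. i j \<le> l j \<and> g j = p j ^ i j"
      by metis
    then have d_eq: "d = (\<Prod>j=1..k. p j ^ i j)"
      unfolding g(2) by (intro prod.cong) auto
    \<comment> \<open>If all exponents vanished, \<open>d\<close> would be 1.\<close>
    then have "\<exists>j\<in>{1..k}. i j \<noteq> 0"
      using d by (auto intro: ccontr)
    then show "h d = h n"
      using h_eq i d_eq by auto
  qed
  finally show ?thesis .
qed

end
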